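(* Let $V$ be a finite nonempty set. A strict ternary relation $\mathcal{B}$ on $V$ is a strict tree betweenness if and only if it satisfies all of the following conditions: $(S_1)$ for all $u,v,w\in V$: $(u,v,w)\in\mathcal{B}$ implies $(w,v,u)\in\mathcal{B}$; $(S_2)$ for all $u,v,w,z\in V$: $(u,v,w)\in\mathcal{B}$ and $(v,w,z)\in\mathcal{B}$ imply $(u,w,z)\in\mathcal{B}$; $(S_3)$ for all $u,v,w,z\in V$: $(u,v,w)\in\mathcal{B}$ and $(u,w,z)\in\mathcal{B}$ imply $(v,w,z)\in\mathcal{B}$; $(S_4)$ for all $u,v,w\in V$: $N(u,v,w)$ implies that there exists $c\in V$ such that $(u,c,v)\in\mathcal{B}$ and $(u,c,w)\in\mathcal{B}$.
   Context: A tree is a finite, simple, undirected, connected graph without cycles. A ternary relation on a set $V$ is a subset of $V^3$; a ternary relation $\mathcal{B}$ is called strict if $(x,y,z)\in\mathcal{B}$ implies that $x,y,z$ are pairwise distinct. The strict tree betweenness of a tree $T$ is the set of all ordered triples $(x,y,z)$ such that $x,y,z$ are pairwise distinct vertices of $T$ and $y$ belongs to the path in $T$ that joins $x$ and $z$. A ternary relation on $V$ is a strict tree betweenness if it is the strict tree betweenness of some tree with vertex set $V$. Given the ternary relation $\mathcal{B}$ on $V$, $N(u,v,w)$ means that $u,v,w$ are pairwise distinct elements of $V$ and $(u,v,w)\notin\mathcal{B}$, $(v,w,u)\notin\mathcal{B}$, $(w,u,v)\notin\mathcal{B}$. *)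

theory Defs
  imports "Graph_Theory.Graph_Theory"
begin

text \<open>
  Finite simple undirected graphs are rendered by the locale \<open>pair_graph\<close>, in which every
  undirected edge is a pair of opposite arcs. Every edge therefore gives rise to closed arc walks
  \<open>u, v, u\<close>, which \<open>pre_digraph.cycle\<close> admits although they are not cycles of the undirected
  graph. Hence cycles are required to have at least three arcs, and neither \<open>forest\<close> nor \<open>tree\<close>
  of \<open>Graph_Theory.Digraph_Component\<close> can be used. Connected graphs are nonempty by definition.
\<close>

definition undirected_tree :: "'a pair_pre_digraph \<Rightarrow> bool" where
  "undirected_tree T \<longleftrightarrow>
     pair_graph T \<and> connected (with_proj T) \<and>
     \<not> (\<exists>p. pre_digraph.cycle (with_proj T) p \<and> 3 \<le> length p)"

definition strict_ternary :: "('a \<times> 'a \<times> 'a) set \<Rightarrow> bool" where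
  "strict_ternary B \<longleftrightarrow> (\<forall>x y z. (x, y, z) \<in> B \<longrightarrow> x \<noteq> y \<and> y \<noteq> z \<and> x \<noteq> z)"

text \<open>
  In a tree, the path \<open>p\<close> from \<open>x\<close> to \<open>z\<close> below is unique.
\<close>

definition betweenness_of_tree :: "'a pair_pre_digraph \<Rightarrow> ('a \<times> 'a \<times> 'a) set" where
  "betweenness_of_tree T =
     {(x, y, z). x \<in> pverts T \<and> y \<in> pverts T \<and> z \<in> pverts T \<and>
        x \<noteq> y \<and> y \<noteq> z \<and> x \<noteq> z \<and>
        (\<exists>p. pre_digraph.apath (with_proj T) x p z \<and>
             y \<in> set (pre_digraph.awalk_verts (with_proj T) x p))}"

definition strict_tree_betweenness :: "'a set \<Rightarrow> ('a \<times> 'a \<times> 'a) set \<Rightarrow> bool" where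
  "strict_tree_betweenness V B \<longleftrightarrow>
     (\<exists>T. undirected_tree T \<and> pverts T = V \<and> B = betweenness_of_tree T)"

definition non_collinear :: "'a set \<Rightarrow> ('a \<times> 'a \<times> 'a) set \<Rightarrow> 'a \<Rightarrow> 'a \<Rightarrow> 'a \<Rightarrow> bool" where
  "non_collinear V B u v w \<longleftrightarrow>
     u \<in> V \<and> v \<in> V \<and> w \<in> V \<and> u \<noteq> v \<and> v \<noteq> w \<and> u \<noteq> w \<and>
     (u, v, w) \<notin> B \<and> (v, w, u) \<notin> B \<and> (w, u, v) \<notin> B"

end

theory Submission
  imports Defs
begin

text \<open>
  In a tree, paths are unique, so the vertex set \<open>seg x y\<close> of the path from \<open>x\<close> to \<open>y\<close> is
  well defined, and the four conditions follow from the way these sets split at an inner vertex.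

  Conversely, join two elements of \<open>V\<close> by an edge if nothing lies between them. If \<open>xy\<close> and \<open>yz\<close>
  are edges with \<open>x \<noteq> z\<close>, then \<open>y\<close> lies between \<open>x\<close> and \<open>z\<close>, since otherwise $(S_4)$ would place
  an element inside an edge. Repeated use of $(S_2)$ along a path from \<open>x\<close> then shows that every
  inner vertex lies between \<open>x\<close> and the end. For a cycle this would put a vertex between \<open>x\<close>
  and \<open>x\<close>, so the graph is a tree; it is connected by induction on the number of elements between
  two vertices.
\<close>

section \<open>Uniqueness of paths in acyclic graphs\<close>

locale acyclic_pair_graph = pair_graph +
  assumes acyclic: "cycle p \<Longrightarrow> length p < 3"
begin

text \<open>A shared first arc is stripped off by induction. If the first arcs differ, following
  \<open>q\<close> until it meets the rest of \<open>p\<close> and returning along \<open>p\<close>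
  closes a cycle of at least three arcs.\<close>

lemma apath_unique:
  assumes "apath u p v" "apath u q v"
  shows "p = q"
  using assms
proof (induction p arbitrary: u q)
  case Nil
  then show ?case
    by (metis apath_Nil_iff apath_nonempty_ends)
next
  case (Cons e p)
  from Cons.prems have "u \<noteq> v"
    using apath_nonempty_ends by blast
  then obtain f q' where q: "q = f # q'"
    using Cons.prems(2) by (cases q) (auto simp: apath_Nil_iff)
  have e: "e \<in> parcs G" "fst e = u" "apath (snd e) p v" "u \<notin> set (pawalk_verts (snd e) p)"
    using Cons.prems(1) by (auto simp: apath_Cons_iff)
  have f: "f \<in> parcs G" "fst f = u" "apath (snd f) q' v" "u \<notin> set (pawalk_verts (snd f) q')"
    using Cons.prems(2) by (auto simp: apath_Cons_iff q)
  show ?case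
  proof (cases "e = f")
    case True
    then show ?thesis
      using Cons.IH[OF e(3), of q'] f(3) q by simp
  next
    case False
    have walks: "awalk (snd e) p v" "awalk (snd f) q' v"
      using e(3) f(3) by (auto simp: apath_def)
    have dist: "distinct (pawalk_verts (snd e) p)" "distinct (pawalk_verts (snd f) q')"
      using e(3) f(3) by (auto simp: apath_def)
    \<comment> \<open>Both remainders end in \<open>v\<close>, so the one after \<open>f\<close> has
      a first vertex \<open>w\<close> on the one after \<open>e\<close>. Its being first keeps the
      vertices \<open>xs\<close> before it off that path.\<close>
    have "v \<in> set (pawalk_verts (snd e) p)" "v \<in> set (pawalk_verts (snd f) q')"
      using walks awalk_verts_non_Nil by (metis awlast_of_awalk last_in_set awalkE')+
    then obtain xs w ys where split: "pawalk_verts (snd f) q' = xs @ w # ys"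
        and w: "w \<in> set (pawalk_verts (snd e) p)"
        and xs: "\<forall>x\<in>set xs. x \<notin> set (pawalk_verts (snd e) p)"
      using split_list_first_prop[of "pawalk_verts (snd f) q'" "\<lambda>x. x \<in> set (pawalk_verts (snd e) p)"]
      by blast
    obtain q1 q2 where q12: "q' = q1 @ q2" "pcas (snd f) q1 w" "pawalk_verts (snd f) q1 = xs @ [w]"
      using walks(2) split by (elim awalkE') (erule (1) awalk_decomp_verts, blast)
    have q1: "awalk (snd f) q1 w"
      using walks(2) q12 by auto
    obtain p1 p2 where p12: "p = p1 @ p2" "awalk (snd e) p1 w" "awalk w p2 v"
      using awalk_decomp[OF walks(1) w] by blast
    have verts_p: "pawalk_verts (snd e) p = pawalk_verts (snd e) p1 @ tl (pawalk_verts w p2)"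
      using walks(1) p12 awalk_verts_append[of "snd e" p1 p2 v] by auto
    have there: "awalk u (f # q1) w"
      using f q1 by (auto simp: awalk_Cons_iff)
    have return: "awalk w (rev_path (e # p1)) u"
      using e p12(2) unfolding awalk_rev_path by (auto simp: awalk_Cons_iff)
    have ep1: "awalk u (e # p1) w"
      using e p12(2) by (auto simp: awalk_Cons_iff)
    let ?c = "(f # q1) @ rev_path (e # p1)"
    have c: "awalk u ?c u"
      using there return by (rule awalk_appendI)
    have last_p1: "last (pawalk_verts (snd e) p1) = w"
      using p12(2) by auto
    have "pawalk_verts u ?c = pawalk_verts u (f # q1) @ tl (pawalk_verts w (rev_path (e # p1)))"
      using awalk_verts_append[OF c] awlast_of_awalk[OF there] by (metis awalkE' there)
    also have "pawalk_verts w (rev_path (e # p1)) = rev (pawalk_verts u (e # p1))"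
      using awalk_verts_rev_path[OF ep1] by simp
    also have "pawalk_verts u (f # q1) @ tl (rev (pawalk_verts u (e # p1)))
        = u # xs @ rev (pawalk_verts u (e # p1))"
    proof -
      have "rev (pawalk_verts u (e # p1)) = w # tl (rev (pawalk_verts u (e # p1)))"
        using last_p1 ep1 awalk_verts_non_Nil[of u "e # p1"]
        by (metis awalkE' hd_rev list.collapse rev_is_Nil_conv)
      then show ?thesis
        using q12(3) f(2) by (metis append_Cons append_Nil append_assoc pawalk_verts.simps(2))
    qed
    \<comment> \<open>Without its start, the closed walk visits \<open>xs\<close>, then the vertices
      of \<open>p1\<close> backwards, then \<open>u\<close>. These are disjoint by the choice of
      \<open>w\<close>, and \<open>u\<close> recurs on neither remainder.\<close>
    finally have "distinct (tl (pawalk_verts u ?c))"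
      using dist split verts_p xs f(4) e by auto
    then have "cycle ?c"
      using c by (auto simp: cycle_def)
    then have "length ?c < 3"
      by (rule acyclic)
    moreover have "length (rev_path r) = length r" for r :: "('a \<times> 'a) list"
      by (induction r) auto
    \<comment> \<open>The closed walk has \<open>length q1 + length p1 + 2\<close> arcs, so only
      \<open>f\<close> and the reversed \<open>e\<close> are left, and both arcs lead from
      \<open>u\<close> to \<open>w\<close>.\<close>
    ultimately have "q1 = []" "p1 = []"
      by auto
    then have "snd e = snd f"
      using q1 p12(2) by (auto simp: awalk_Nil_iff)
    then show ?thesis
      using False e(2) f(2) by (simp add: prod_eq_iff)
  qed
qed

end

section \<open>Vertex sets of paths in a tree\<close>

locale pair_tree = acyclic_pair_graph +
  assumes connected: "connected G"
begin

lemma ex1_apath: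
  assumes "x \<in> pverts G" "y \<in> pverts G"
  shows "\<exists>!p. apath x p y"
proof -
  have "strongly_connected G"
    using symmetric_connected_imp_strongly_connected pair_sym_arcs connected by blast
  then have "\<exists>p. apath x p y"
    using assms reachable_apath by (auto simp: strongly_connected_def)
  then show ?thesis
    using apath_unique by blast
qed

definition seg :: "'a \<Rightarrow> 'a \<Rightarrow> 'a set" where
  "seg x y = set (pawalk_verts x (THE p. apath x p y))"

lemma seg_eq: "apath x p y \<Longrightarrow> seg x y = set (pawalk_verts x p)"
  unfolding seg_def using apath_unique by (metis the_equality)

lemma seg_subset_verts: "\<lbrakk>x \<in> pverts G; y \<in> pverts G\<rbrakk> \<Longrightarrow> seg x y \<subseteq> pverts G"
  using ex1_apath seg_eq by (metis apath_def awalkE')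

lemma seg_commute:
  assumes "x \<in> pverts G" "y \<in> pverts G"
  shows "seg x y = seg y x"
proof -
  obtain p where p: "apath x p y"
    using ex1_apath[OF assms] by blast
  then have "apath y (rev_path p) x"
    by simp
  from seg_eq[OF this] seg_eq[OF p] show ?thesis
    using p awalk_verts_rev_path[of x p y] by (auto simp: apath_def)
qed

lemma ends_in_seg:
  assumes "x \<in> pverts G" "y \<in> pverts G"
  shows "x \<in> seg x y" "y \<in> seg x y"
proof -
  have "x \<in> seg x y" if "x \<in> pverts G" "y \<in> pverts G" for x y
    using ex1_apath[OF that] seg_eq hd_in_awalk_verts(2) by metis
  then show "x \<in> seg x y" "y \<in> seg x y"
    using assms seg_commute by blast+
qed

text \<open>Cutting the path at \<open>y\<close> leaves two paths, which by uniqueness are those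
  defining \<open>seg x y\<close> and \<open>seg y z\<close>. As the whole path repeats no vertex,
  they share only \<open>y\<close>.\<close>

lemma
  assumes "x \<in> pverts G" "z \<in> pverts G" "y \<in> seg x z"
  shows seg_split: "seg x z = seg x y \<union> seg y z"
    and seg_split_disjoint: "seg x y \<inter> seg y z = {y}"
proof -
  obtain p where p: "apath x p z"
    using ex1_apath[OF assms(1,2)] by blast
  then have "awalk x p z" "y \<in> set (pawalk_verts x p)"
    using seg_eq assms(3) by (auto simp: apath_def)
  then obtain q r where qr: "p = q @ r" "awalk x q y" "awalk y r z"
    using awalk_decomp by blast
  then have last: "last (pawalk_verts x q) = y"
    by auto
  then have path: "apath x q y" "apath y r z"
      "set (pawalk_verts x q) \<inter> set (tl (pawalk_verts y r)) = {}"
    using p qr(1) by (auto simp: apath_append_iff)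
  show "seg x z = seg x y \<union> seg y z"
    using seg_eq[OF p] seg_eq[OF path(1)] seg_eq[OF path(2)] set_awalk_verts_append[OF qr(2,3)] qr(1)
    by simp
  have "pawalk_verts y r = y # tl (pawalk_verts y r)"
    using qr(3) by (metis awalkE' awalk_verts_non_Nil list.collapse)
  then have "set (pawalk_verts y r) = insert y (set (tl (pawalk_verts y r)))"
    by (metis list.simps(15))
  moreover have "y \<in> set (pawalk_verts x q)"
    using last awalk_verts_non_Nil by (metis last_in_set)
  ultimately show "seg x y \<inter> seg y z = {y}"
    using seg_eq[OF path(1)] seg_eq[OF path(2)] path(3) by auto
qed

text \<open>Two paths that meet only at \<open>y\<close> concatenate to a path, which by uniqueness
  is the one from \<open>x\<close> to \<open>z\<close>. This is the converse of
  \<open>seg_split_disjoint\<close>.\<close>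

lemma in_segI:
  assumes "x \<in> pverts G" "y \<in> pverts G" "z \<in> pverts G" "seg x y \<inter> seg y z \<subseteq> {y}"
  shows "y \<in> seg x z"
proof -
  obtain p where p: "apath x p y"
    using ex1_apath[OF assms(1,2)] by blast
  obtain q where q: "apath y q z"
    using ex1_apath[OF assms(2,3)] by blast
  have walks: "awalk x p y" "awalk y q z"
    using p q by (auto simp: apath_def)
  have "pawalk_verts y q = y # tl (pawalk_verts y q)"
    using walks(2) by (metis awalkE' awalk_verts_non_Nil list.collapse)
  then have "y \<notin> set (tl (pawalk_verts y q))"
    using q by (metis apath_def distinct.simps(2))
  then have "set (pawalk_verts x p) \<inter> set (tl (pawalk_verts y q)) = {}"
    using assms(4) seg_eq[OF p] seg_eq[OF q] by (auto dest: list.set_sel(2)[OF awalk_verts_non_Nil])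
  then have "apath x (p @ q) z"
    using p q walks by (auto simp: apath_append_iff)
  from seg_eq[OF this] show ?thesis
    using set_awalk_verts_append[OF walks] hd_in_awalk_verts(1)[OF walks(2)] by simp
qed

lemma betweenness_iff:
  "(x, y, z) \<in> betweenness_of_tree G \<longleftrightarrow>
     x \<in> pverts G \<and> y \<in> pverts G \<and> z \<in> pverts G \<and> x \<noteq> y \<and> y \<noteq> z \<and> x \<noteq> z \<and> y \<in> seg x z"
proof -
  have "(\<exists>p. apath x p z \<and> y \<in> set (pawalk_verts x p)) \<longleftrightarrow> y \<in> seg x z"
    if "x \<in> pverts G" "z \<in> pverts G"
    using ex1_apath[OF that] seg_eq by blast
  then show ?thesis
    unfolding betweenness_of_tree_def by auto
qed

section \<open>The four conditions in a tree\<close>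

lemma betweenness_sym:
  "(u, v, w) \<in> betweenness_of_tree G \<Longrightarrow> (w, v, u) \<in> betweenness_of_tree G"
  using seg_commute by (auto simp: betweenness_iff)

text \<open>By \<open>in_segI\<close>, \<open>seg u w\<close> and \<open>seg w z\<close> need only
  be shown to meet in \<open>w\<close> alone. A common vertex in \<open>seg u v\<close> would force
  \<open>v\<close> into \<open>seg w z\<close>; one in \<open>seg v w\<close> is
  \<open>w\<close>.\<close>

lemma betweenness_extend:
  assumes "(u, v, w) \<in> betweenness_of_tree G" "(v, w, z) \<in> betweenness_of_tree G"
  shows "(u, w, z) \<in> betweenness_of_tree G"
proof -
  have V: "u \<in> pverts G" "v \<in> pverts G" "w \<in> pverts G" "z \<in> pverts G"
    and ne: "u \<noteq> v" "v \<noteq> w" "u \<noteq> w" "w \<noteq> z"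
    and v: "v \<in> seg u w" and w: "w \<in> seg v z"
    using assms by (auto simp: betweenness_iff)
  have v_wz: "v \<notin> seg w z"
    using seg_split_disjoint[OF V(2,4) w] ends_in_seg[OF V(2,3)] ne by blast
  have "seg u w \<inter> seg w z \<subseteq> {w}"
  proof
    fix t assume t: "t \<in> seg u w \<inter> seg w z"
    then have tV: "t \<in> pverts G"
      using seg_subset_verts V by blast
    show "t \<in> {w}"
    proof (cases "t \<in> seg u v")
      case True
      have "seg t v \<inter> seg v w \<subseteq> {v}"
        using seg_split[OF V(1,2) True] seg_split_disjoint[OF V(1,3) v] by blast
      then have "v \<in> seg t w"
        using in_segI tV V by blast
      then have "v \<in> seg w t"
        using seg_commute tV V by blast
      moreover have "seg w t \<subseteq> seg w z"
        using seg_split[OF V(3,4), of t] t by blast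
      ultimately show ?thesis
        using v_wz by blast
    next
      case False
      then have "t \<in> seg v w"
        using t seg_split[OF V(1,3) v] by blast
      then show ?thesis
        using t seg_split_disjoint[OF V(2,4) w] by blast
    qed
  qed
  then have "w \<in> seg u z"
    using in_segI V by blast
  moreover have "u \<noteq> z"
    using v v_wz seg_commute[OF V(1,3)] by blast
  ultimately show ?thesis
    using V ne by (auto simp: betweenness_iff)
qed

text \<open>The path from \<open>v\<close> to \<open>w\<close> is part of the path from
  \<open>u\<close> to \<open>w\<close>, so it too meets \<open>seg w z\<close> only in
  \<open>w\<close>.\<close>

lemma betweenness_shorten:
  assumes "(u, v, w) \<in> betweenness_of_tree G" "(u, w, z) \<in> betweenness_of_tree G"
  shows "(v, w, z) \<in> betweenness_of_tree G"
proof -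
  have V: "u \<in> pverts G" "v \<in> pverts G" "w \<in> pverts G" "z \<in> pverts G"
    and ne: "v \<noteq> w" "w \<noteq> z"
    and v: "v \<in> seg u w" and w: "w \<in> seg u z"
    using assms by (auto simp: betweenness_iff)
  have disjoint: "seg u w \<inter> seg w z = {w}"
    by (rule seg_split_disjoint[OF V(1,4) w])
  then have "w \<in> seg v z"
    using in_segI[OF V(2,3,4)] seg_split[OF V(1,3) v] by blast
  moreover have "v \<noteq> z"
    using disjoint v ne ends_in_seg[OF V(3,4)] by blast
  ultimately show ?thesis
    using V ne by (auto simp: betweenness_iff)
qed

text \<open>The branching point is the last vertex of the path from \<open>u\<close> to \<open>v\<close> that lies on the path
  from \<open>u\<close> to \<open>w\<close>.\<close>

lemma betweenness_branch:
  assumes "non_collinear (pverts G) (betweenness_of_tree G) u v w"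
  shows "\<exists>c. (u, c, v) \<in> betweenness_of_tree G \<and> (u, c, w) \<in> betweenness_of_tree G"
proof -
  have V: "u \<in> pverts G" "v \<in> pverts G" "w \<in> pverts G"
    and ne: "u \<noteq> v" "v \<noteq> w" "u \<noteq> w"
    and notin: "v \<notin> seg u w" "w \<notin> seg u v" "u \<notin> seg v w"
    using assms seg_commute by (auto simp: non_collinear_def betweenness_iff)
  obtain p where p: "apath u p v"
    using ex1_apath[OF V(1,2)] by blast
  have uv: "seg u v = set (pawalk_verts u p)"
    by (rule seg_eq[OF p])
  have "\<exists>c\<in>set (pawalk_verts u p). c \<in> seg u w"
    using ends_in_seg V uv by blast
  then obtain xs c ys where split: "pawalk_verts u p = xs @ c # ys" and c: "c \<in> seg u w"
      and ys: "\<forall>y\<in>set ys. y \<notin> seg u w"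
    using split_list_last_prop[of "pawalk_verts u p" "\<lambda>x. x \<in> seg u w"] by blast
  \<comment> \<open>Otherwise the paths from \<open>u\<close> to \<open>v\<close> and to
    \<open>w\<close> share only \<open>u\<close>, and \<open>in_segI\<close> puts \<open>u\<close>
    between \<open>v\<close> and \<open>w\<close>.\<close>
  have "c \<noteq> u"
  proof
    assume "c = u"
    moreover have "hd (pawalk_verts u p) = u" "distinct (pawalk_verts u p)"
      using p by (auto simp: apath_def)
    ultimately have "xs = []"
      using split by (cases xs) auto
    then have "seg u v = insert u (set ys)"
      using split uv \<open>c = u\<close> by simp
    then have "seg v u \<inter> seg u w \<subseteq> {u}"
      using ys seg_commute V by blast
    then show False
      using in_segI V notin(3) by blast
  qed
  moreover have "c \<in> seg u v"
    using split uv by simp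
  ultimately show ?thesis
    using c V ne notin seg_subset_verts[OF V(1,2)] by (auto simp: betweenness_iff)
qed

end

lemma undirected_tree_iff: "undirected_tree T \<longleftrightarrow> pair_tree T"
  unfolding undirected_tree_def pair_tree_def pair_tree_axioms_def acyclic_pair_graph_def
    acyclic_pair_graph_axioms_def
  by (auto simp: not_less)

section \<open>The graph of pairs with nothing between them\<close>

locale tree_like_betweenness =
  fixes V :: "'a set" and B :: "('a \<times> 'a \<times> 'a) set"
  assumes finite_V: "finite V" and nonempty_V: "V \<noteq> {}"
    and B_subset: "B \<subseteq> V \<times> V \<times> V" and strict: "strict_ternary B"
    and sym: "(u, v, w) \<in> B \<Longrightarrow> (w, v, u) \<in> B"
    and extend: "\<lbrakk>(u, v, w) \<in> B; (v, w, z) \<in> B\<rbrakk> \<Longrightarrow> (u, w, z) \<in> B"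
    and shorten: "\<lbrakk>(u, v, w) \<in> B; (u, w, z) \<in> B\<rbrakk> \<Longrightarrow> (v, w, z) \<in> B"
    and branch: "non_collinear V B u v w \<Longrightarrow> \<exists>c. (u, c, v) \<in> B \<and> (u, c, w) \<in> B"
begin

lemma B_in_V: "(u, v, w) \<in> B \<Longrightarrow> u \<in> V \<and> v \<in> V \<and> w \<in> V"
  using B_subset by auto

lemma B_distinct: "(u, v, w) \<in> B \<Longrightarrow> u \<noteq> v \<and> v \<noteq> w \<and> u \<noteq> w"
  using strict by (auto simp: strict_ternary_def)

text \<open>\<open>shorten\<close> gives \<open>(v, w, z)\<close>. Read backwards, this and
  \<open>(u, v, w)\<close> combine by \<open>extend\<close> to \<open>(z, v, u)\<close>.\<close>

lemma trans_outer: "\<lbrakk>(u, v, w) \<in> B; (u, w, z) \<in> B\<rbrakk> \<Longrightarrow> (u, v, z) \<in> B"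
  by (meson sym extend shorten)

text \<open>This is the only candidate: in a tree, two distinct vertices are adjacent exactly if no
  vertex lies between them.\<close>

definition cover_graph :: "'a pair_pre_digraph" where
  "cover_graph = \<lparr>pverts = V, parcs = {(x, y). x \<in> V \<and> y \<in> V \<and> x \<noteq> y \<and> (\<forall>c. (x, c, y) \<notin> B)}\<rparr>"

lemma pverts_cover_graph [simp]: "pverts cover_graph = V"
  by (simp add: cover_graph_def)

lemma parcs_cover_graph_iff:
  "(x, y) \<in> parcs cover_graph \<longleftrightarrow> x \<in> V \<and> y \<in> V \<and> x \<noteq> y \<and> (\<forall>c. (x, c, y) \<notin> B)"
  by (simp add: cover_graph_def)

sublocale cover: pair_graph cover_graph
proof
  show "finite (parcs cover_graph)"
    by (rule finite_subset[of _ "V \<times> V"]) (auto simp: cover_graph_def finite_V)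
  show "symmetric (with_proj cover_graph)"
    unfolding symmetric_def
    by (rule symI) (auto simp: parcs_cover_graph_iff dest: sym)
qed (auto simp: parcs_cover_graph_iff finite_V)

lemma adjacent_arcs_between:
  assumes "(x, y) \<in> parcs cover_graph" "(y, z) \<in> parcs cover_graph" "x \<noteq> z"
  shows "(x, y, z) \<in> B"
  using assms branch[of x y z] sym unfolding parcs_cover_graph_iff non_collinear_def by blast

text \<open>If the conclusion fails, every order of \<open>a\<close>, \<open>y\<close>,
  \<open>z\<close> is impossible, so \<open>branch\<close> applied at \<open>a\<close> places an
  element between the adjacent \<open>a\<close> and \<open>z\<close>.\<close>

lemma between_cover_cases:
  assumes "(x, y, z) \<in> B" "(x, a, z) \<in> B" "(a, z) \<in> parcs cover_graph" "y \<noteq> a"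
  shows "(x, y, a) \<in> B"
proof (rule ccontr)
  assume "(x, y, a) \<notin> B"
  have no: "(a, c, z) \<notin> B" for c
    using assms(3) by (auto simp: parcs_cover_graph_iff)
  \<comment> \<open>Read from \<open>z\<close>, this triple and \<open>(x, y, z)\<close> would give
    \<open>(a, y, x)\<close> by \<open>shorten\<close>.\<close>
  have "(y, a, z) \<notin> B"
    using \<open>(x, y, a) \<notin> B\<close> shorten[of z a y x] sym[of x y z] sym[of y a z] sym[of a y x] assms(1)
    by blast
  \<comment> \<open>This triple would yield \<open>(x, z, a)\<close> by \<open>extend\<close>, and
    with \<open>(x, a, z)\<close> the degenerate \<open>(a, z, a)\<close>.\<close>
  moreover have "(a, z, y) \<notin> B"
    using extend[of x y z a] shorten[of x a z a] B_distinct sym[of a z y] assms(1,2) by blast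
  ultimately have "non_collinear V B a y z"
    using no[of y] sym[of y z a] sym[of z a y] assms B_in_V[OF assms(1)] B_in_V[OF assms(2)]
      B_distinct[OF assms(1)] B_distinct[OF assms(2)]
    unfolding non_collinear_def by blast
  then show False
    using branch no by blast
qed

text \<open>Induction from the far end of the path: removing the last arc \<open>(a, z)\<close>
  loses exactly \<open>a\<close> from the elements between \<open>x\<close> and the end.\<close>

lemma between_iff_on_apath:
  assumes "cover.apath x p z" "y \<noteq> x" "y \<noteq> z" "x \<noteq> z"
  shows "(x, y, z) \<in> B \<longleftrightarrow> y \<in> set (pawalk_verts x p)"
  using assms
proof (induction p arbitrary: y z rule: rev_induct)
  case Nil
  then show ?case by (simp add: cover.apath_Nil_iff)
next
  case (snoc e q)
  obtain a where e: "e = (a, z)"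
    using snoc.prems(1) by (cases e) (auto simp: cover.apath_append_iff cover.apath_simps)
  have q: "cover.apath x q a" and az: "(a, z) \<in> parcs cover_graph"
    and z: "z \<notin> set (pawalk_verts x q)"
    and verts: "pawalk_verts x (q @ [e]) = pawalk_verts x q @ [z]"
    using snoc.prems(1) cover.awalk_verts_append[of x q "[e]" z]
    by (auto simp: e cover.apath_append_iff cover.apath_simps cover.apath_def cover.awalk_simps)
  show ?case
  proof (cases "a = x")
    case True
    then have "q = []"
      using q cover.apath_nonempty_ends by blast
    then show ?thesis
      using az True snoc.prems verts by (auto simp: parcs_cover_graph_iff)
  next
    case False
    then have "q \<noteq> []"
      using q by (auto simp: cover.apath_Nil_iff)
    then obtain q' f where q': "q = q' @ [f]"
      by (metis rev_exhaust)
    obtain b where f: "f = (b, a)"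
      using q by (cases f) (auto simp: q' cover.apath_append_iff cover.apath_simps)
    have ba: "(b, a) \<in> parcs cover_graph" and b: "b \<in> set (pawalk_verts x q)"
      using q cover.awalk_verts_arc1[of f q x]
      by (auto simp: f q' cover.apath_append_iff cover.apath_simps)
    \<comment> \<open>The predecessor \<open>b\<close> of \<open>a\<close> links the last arc to the
      rest: unless \<open>b = x\<close>, the induction hypothesis gives \<open>(x, b, a)\<close>,
      and \<open>extend\<close> then puts \<open>a\<close> between \<open>x\<close> and
      \<open>z\<close>.\<close>
    have "(b, a, z) \<in> B"
      using adjacent_arcs_between[OF ba az] b z by blast
    moreover have "b = x \<or> (x, b, a) \<in> B"
      using snoc.IH[OF q, of b] b ba False by (auto simp: parcs_cover_graph_iff)
    ultimately have xaz: "(x, a, z) \<in> B"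
      using extend by blast
    have a: "a \<in> set (pawalk_verts x q)"
      using q cover.awalk_verts_non_Nil[of x q] by (metis cover.apath_def cover.awalkE' last_in_set)
    show ?thesis
    proof (cases "y = a")
      case True
      then show ?thesis using xaz a verts by simp
    next
      case y: False
      then have "(x, y, z) \<in> B \<longleftrightarrow> (x, y, a) \<in> B"
        using between_cover_cases[OF _ xaz az] trans_outer[OF _ xaz] by blast
      then show ?thesis
        using snoc.IH[OF q, of y] y False snoc.prems verts by auto
    qed
  qed
qed

section \<open>The cover graph is a tree with betweenness \<open>B\<close>\<close>

lemma cover_graph_reachable:
  assumes "x \<in> V" "y \<in> V"
  shows "x \<rightarrow>\<^sup>*\<^bsub>with_proj cover_graph\<^esub> y"
  using assms
proof (induction "card {c. (x, c, y) \<in> B}" arbitrary: x y rule: less_induct)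
  case less
  have fin: "finite {c. (x, c, y) \<in> B}"
    by (rule finite_subset[OF _ finite_V]) (auto dest: B_in_V)
  show ?case
  proof (cases "\<exists>c. (x, c, y) \<in> B")
    case True
    then obtain c where c: "(x, c, y) \<in> B" by blast
    \<comment> \<open>Both inclusions are strict because \<open>c\<close> itself lies between
      \<open>x\<close> and \<open>y\<close> but is an endpoint of either part.\<close>
    have "{d. (x, d, c) \<in> B} \<subset> {d. (x, d, y) \<in> B}"
      using c B_distinct trans_outer[OF _ c] by blast
    moreover have "{d. (c, d, y) \<in> B} \<subset> {d. (x, d, y) \<in> B}"
      using c B_distinct extend[OF c] sym[of c _ y] sym[of x c y] sym[of y _ x]
        trans_outer[of y _ c x] by blast
    ultimately have "card {d. (x, d, c) \<in> B} < card {d. (x, d, y) \<in> B}"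
        "card {d. (c, d, y) \<in> B} < card {d. (x, d, y) \<in> B}"
      using fin by (auto intro: psubset_card_mono)
    then have "x \<rightarrow>\<^sup>*\<^bsub>with_proj cover_graph\<^esub> c" "c \<rightarrow>\<^sup>*\<^bsub>with_proj cover_graph\<^esub> y"
      using less B_in_V[OF c] by auto
    then show ?thesis
      by (rule cover.reachable_trans)
  next
    case False
    then show ?thesis
      using less.prems by (cases "x = y") (auto simp: parcs_cover_graph_iff intro: cover.adj_reachable_trans)
  qed
qed

text \<open>Let \<open>b\<close>, \<open>a\<close>, \<open>u\<close> be the last three vertices of a
  long cycle based at \<open>u\<close>. Then \<open>(u, b, a)\<close> and \<open>(b, a, u)\<close>
  give \<open>(u, a, u)\<close> by \<open>extend\<close>.\<close>

lemma cover_graph_cycle: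
  assumes "cover.cycle p"
  shows "length p < 3"
proof (rule ccontr)
  assume "\<not> length p < 3"
  from assms obtain u where u: "cover.awalk u p u" "distinct (tl (pawalk_verts u p))" "p \<noteq> []"
    by (auto simp: cover.cycle_def)
  then obtain q e where q: "p = q @ [e]"
    by (metis rev_exhaust)
  have "q \<noteq> []"
    using \<open>\<not> length p < 3\<close> q by auto
  then obtain r f where r: "q = r @ [f]"
    by (metis rev_exhaust)
  obtain a where e: "e = (a, u)"
    using u(1) by (cases e) (auto simp: q cover.awalk_simps)
  have walk: "cover.awalk u q a" and au: "(a, u) \<in> parcs cover_graph"
    using u(1) by (auto simp: q e cover.awalk_simps)
  have "pawalk_verts u p = pawalk_verts u q @ [u]"
    using u(1) walk cover.awalk_verts_append[of u q "[e]" u] by (auto simp: q cover.awalk_simps)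
  moreover have "pawalk_verts u q = u # tl (pawalk_verts u q)"
    using walk by (metis cover.awalkE' cover.awalk_verts_non_Nil list.collapse)
  \<comment> \<open>The tail known to be distinct is the rotation of \<open>pawalk_verts u q\<close>
    that moves its first element \<open>u\<close> to the end.\<close>
  ultimately have "distinct (pawalk_verts u q)"
    using u(2) by (metis append_Cons distinct.simps(2) distinct_append list.sel(3) rotate1.simps(2) distinct1_rotate)
  then have path: "cover.apath u q a"
    using walk by (simp add: cover.apath_def)
  then obtain b where f: "f = (b, a)"
    by (cases f) (auto simp: r cover.apath_append_iff cover.apath_simps)
  have ba: "(b, a) \<in> parcs cover_graph" and rb: "cover.apath u r b"
      and b: "b \<in> set (pawalk_verts u q)"
    using path cover.awalk_verts_arc1[of f q u]
    by (auto simp: f r cover.apath_append_iff cover.apath_simps)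
  \<comment> \<open>Here the third arc matters: on a closed walk \<open>u, a, u\<close> the vertex
    \<open>b\<close> would be \<open>u\<close>.\<close>
  have "r \<noteq> []"
    using \<open>\<not> length p < 3\<close> q r by auto
  then have "b \<noteq> u"
    using rb cover.apath_nonempty_ends by blast
  then have "(b, a, u) \<in> B"
    using adjacent_arcs_between[OF ba au] by blast
  moreover have "(u, b, a) \<in> B"
    using between_iff_on_apath[OF path, of b] b \<open>b \<noteq> u\<close> ba au by (auto simp: parcs_cover_graph_iff)
  ultimately show False
    using extend B_distinct by blast
qed

lemma undirected_tree_cover_graph: "undirected_tree cover_graph"
proof -
  have "connected (with_proj cover_graph)"
    using nonempty_V cover_graph_reachable
    by (intro cover.connectedI) (auto intro: cover.reachable_mk_symmetricI)
  then show ?thesis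
    using cover_graph_cycle unfolding undirected_tree_def by (force intro: cover.pair_graph)
qed

text \<open>\<open>between_iff_on_apath\<close> holds for every path, so any path supplied by
  reachability decides membership.\<close>

lemma betweenness_of_cover_graph: "betweenness_of_tree cover_graph = B"
proof -
  have "(x, y, z) \<in> betweenness_of_tree cover_graph \<longleftrightarrow> (x, y, z) \<in> B" for x y z
  proof (cases "x \<in> V \<and> y \<in> V \<and> z \<in> V \<and> x \<noteq> y \<and> y \<noteq> z \<and> x \<noteq> z")
    case True
    then obtain p where p: "cover.apath x p z"
      using cover_graph_reachable cover.reachable_apath by blast
    show ?thesis
      using True p between_iff_on_apath[of x _ z y]
      by (auto simp: betweenness_of_tree_def)
  next
    case False
    then show ?thesis
      using B_in_V[of x y z] B_distinct[of x y z] by (auto simp: betweenness_of_tree_def)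
  qed
  then show ?thesis by auto
qed

end

section \<open>The equivalence\<close>

theorem theorem3:
  fixes V :: "'a set" and B :: "('a \<times> 'a \<times> 'a) set"
  assumes "finite V" and "V \<noteq> {}"
    and "B \<subseteq> V \<times> V \<times> V" and "strict_ternary B"
  shows "strict_tree_betweenness V B \<longleftrightarrow>
    (\<forall>u\<in>V. \<forall>v\<in>V. \<forall>w\<in>V. (u, v, w) \<in> B \<longrightarrow> (w, v, u) \<in> B) \<and>
    (\<forall>u\<in>V. \<forall>v\<in>V. \<forall>w\<in>V. \<forall>z\<in>V. (u, v, w) \<in> B \<and> (v, w, z) \<in> B \<longrightarrow> (u, w, z) \<in> B) \<and>
    (\<forall>u\<in>V. \<forall>v\<in>V. \<forall>w\<in>V. \<forall>z\<in>V. (u, v, w) \<in> B \<and> (u, w, z) \<in> B \<longrightarrow> (v, w, z) \<in> B) \<and>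
    (\<forall>u\<in>V. \<forall>v\<in>V. \<forall>w\<in>V. non_collinear V B u v w \<longrightarrow>
       (\<exists>c\<in>V. (u, c, v) \<in> B \<and> (u, c, w) \<in> B))"
  (is "_ \<longleftrightarrow> ?S1 \<and> ?S2 \<and> ?S3 \<and> ?S4")
proof
  assume "strict_tree_betweenness V B"
  then obtain T where "pair_tree T" and T: "pverts T = V" "B = betweenness_of_tree T"
    by (auto simp: strict_tree_betweenness_def undirected_tree_iff)
  then interpret pair_tree T by simp
  have "?S1" "?S2" "?S3"
    unfolding T using betweenness_sym betweenness_extend betweenness_shorten by blast+
  moreover have "?S4"
    using betweenness_branch betweenness_iff unfolding T by metis
  ultimately show "?S1 \<and> ?S2 \<and> ?S3 \<and> ?S4" by blast
next
  assume "?S1 \<and> ?S2 \<and> ?S3 \<and> ?S4"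
  then have S1: ?S1 and S2: ?S2 and S3: ?S3 and S4: ?S4
    by - (elim conjE, assumption)+
  \<comment> \<open>Membership in \<open>B\<close> already forces membership in \<open>V\<close>, so
    the bounded conditions yield the unbounded ones of the locale.\<close>
  have in_V: "u \<in> V \<and> v \<in> V \<and> w \<in> V" if "(u, v, w) \<in> B" for u v w
    using that assms(3) by auto
  interpret tree_like_betweenness V B
  proof
    show "(w, v, u) \<in> B" if "(u, v, w) \<in> B" for u v w
      using that in_V S1 by meson
    show "(u, w, z) \<in> B" if "(u, v, w) \<in> B" "(v, w, z) \<in> B" for u v w z
      using that in_V S2 by meson
    show "(v, w, z) \<in> B" if "(u, v, w) \<in> B" "(u, w, z) \<in> B" for u v w z
      using that in_V S3 by meson
    show "\<exists>c. (u, c, v) \<in> B \<and> (u, c, w) \<in> B" if "non_collinear V B u v w" for u v w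
      using that S4 unfolding non_collinear_def by meson
  qed (use assms in auto)
  show "strict_tree_betweenness V B"
    unfolding strict_tree_betweenness_def
    using undirected_tree_cover_graph betweenness_of_cover_graph pverts_cover_graph by metis
qed

end
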